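(* Let $\mathcal I$ be a proper ideal on $\mathbb N$. Assume that there is an operator $Q\colon\ell_\infty\to\ell_\infty$ such that: (A) $Q$ is a positive projection with $\ker Q=c_{0,\mathcal I}$; (B) for each $A\subseteq\mathbb N$ there exists $T(A)\subseteq\mathbb N$ such that $Q(\chi_A)=\chi_{T(A)}$; (C) $T(A\cap B)=T(A)\cap T(B)$ for all $A,B\subseteq\mathbb N$; (D) the family $\mathcal B=\{B\subseteq\mathbb N:T(B)=B\}$ is closed under arbitrary intersections (including the intersection of the empty subfamily, which is $\mathbb N$). Then $\mathcal I$ is discretely represented. Moreover, there are an index set $F$ with $|F|\le\omega$, a discrete collection $\{\mathcal I_m:m\in F\}$ of pairwise distinct maximal ideals on $\mathbb N$ with $\mathcal I=\bigcap_{m\in F}\mathcal I_m$, and a partition $\{A_m:m\in F\}$ of $\mathbb N$ with $A_m\in\mathcal I_m^*$ for each $m\in F$, such that $$Q(\mathbf x)=\sum_{m\in F}(\mathcal I_m^*\text{-}\lim\mathbf x)\,\chi_{A_m}\qquad\text{for all }\mathbf x\in\ell_\infty,$$ and in the case where $Q$ has infinite rank, $\mathcal I$ is strongly $\omega$-maximal.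
   Context: An ideal on $\mathbb N$ is a family of subsets of $\mathbb N$ containing $\emptyset$ and closed under subsets and finite unions; every ideal is assumed to contain all finite sets, and is proper if it is not $\mathcal P(\mathbb N)$. A maximal ideal is a proper ideal whose only proper extension is $\mathcal P(\mathbb N)$. The dual filter of $\mathcal I$ is $\mathcal I^*=\{\mathbb N\setminus A:A\in\mathcal I\}$. A countable collection of maximal ideals is discrete if the set of their dual ultrafilters is a discrete subspace of $\beta\mathbb N$ (the space of ultrafilters on $\mathbb N$). For a positive integer $k$, $\mathcal I$ is $k$-maximal if it is the intersection of $k$ pairwise distinct maximal ideals. $\mathcal I$ is strongly $\omega$-maximal if it is the intersection of a countably infinite discrete collection of maximal ideals. $\mathcal I$ is discretely represented if it is either $k$-maximal for some positive integer $k$ or strongly $\omega$-maximal. $\ell_\infty$ is the real Banach lattice of bounded real sequences with sup norm and coordinatewise order; $c_{0,\mathcal I}$ is the closed subspace of all $(x_n)\in\ell_\infty$ with $\{n:|x_n|\ge\varepsilon\}\in\mathcal I$ for every $\varepsilon>0$. A positive projection is a bounded linear $Q$ with $Q^2=Q$ and $Qx\ge0$ whenever $x\ge0$. $\chi_A$ is the characteristic function of $A$. For a maximal ideal $\mathcal L$ and $\mathbf x=(x_n)\in\ell_\infty$, $\mathcal L^*\text{-}\lim\mathbf x$ is the unique real $a$ with $\{n:|x_n-a|\ge\varepsilon\}\in\mathcal L$ for all $\varepsilon>0$. The sum $\sum_{m\in F}c_m\chi_{A_m}$ with $A_m$ pairwise disjoint and $(c_m)$ bounded is defined coordinatewise.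 *)

theory Defs
  imports "HOL-Analysis.Analysis"
begin

section \<open>Ideals and filters on the natural numbers\<close>

definition nat_ideal :: "nat set set \<Rightarrow> bool" where
  "nat_ideal I \<longleftrightarrow>
     {} \<in> I \<and>
     (\<forall>A\<in>I. \<forall>B. B \<subseteq> A \<longrightarrow> B \<in> I) \<and>
     (\<forall>A\<in>I. \<forall>B\<in>I. A \<union> B \<in> I) \<and>
     (\<forall>A. finite A \<longrightarrow> A \<in> I)"

definition proper_nat_ideal :: "nat set set \<Rightarrow> bool" where
  "proper_nat_ideal I \<longleftrightarrow> nat_ideal I \<and> I \<noteq> UNIV"

definition maximal_nat_ideal :: "nat set set \<Rightarrow> bool" where
  "maximal_nat_ideal I \<longleftrightarrow>
     proper_nat_ideal I \<and> (\<forall>J. nat_ideal J \<and> I \<subset> J \<longrightarrow> J = UNIV)"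

definition dual_filter :: "nat set set \<Rightarrow> nat set set" where
  "dual_filter I = {- A | A. A \<in> I}"

definition proper_nat_filter :: "nat set set \<Rightarrow> bool" where
  "proper_nat_filter U \<longleftrightarrow>
     UNIV \<in> U \<and> {} \<notin> U \<and>
     (\<forall>A\<in>U. \<forall>B. A \<subseteq> B \<longrightarrow> B \<in> U) \<and>
     (\<forall>A\<in>U. \<forall>B\<in>U. A \<inter> B \<in> U)"

text \<open>Unlike ideals, filters are not required to be free: the principal ultrafilters
  are points of \<open>\<beta>\<nat>\<close>.\<close>

definition nat_ultrafilter :: "nat set set \<Rightarrow> bool" where
  "nat_ultrafilter U \<longleftrightarrow>
     proper_nat_filter U \<and> (\<forall>V. proper_nat_filter V \<and> U \<subseteq> V \<longrightarrow> V = U)"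

definition beta_nat :: "nat set set topology" where
  "beta_nat = topology_generated_by (range (\<lambda>A. {U. nat_ultrafilter U \<and> A \<in> U}))"

definition discrete_collection :: "nat set set set \<Rightarrow> bool" where
  "discrete_collection \<M> \<longleftrightarrow>
     countable \<M> \<and> (\<forall>L\<in>\<M>. maximal_nat_ideal L) \<and>
     subtopology beta_nat (dual_filter ` \<M>) = discrete_topology (dual_filter ` \<M>)"

definition k_maximal :: "nat \<Rightarrow> nat set set \<Rightarrow> bool" where
  "k_maximal k I \<longleftrightarrow>
     (\<exists>\<M>. finite \<M> \<and> card \<M> = k \<and> (\<forall>L\<in>\<M>. maximal_nat_ideal L) \<and> I = \<Inter>\<M>)"

definition strongly_omega_maximal :: "nat set set \<Rightarrow> bool" where
  "strongly_omega_maximal I \<longleftrightarrow>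
     (\<exists>\<M>. infinite \<M> \<and> discrete_collection \<M> \<and> I = \<Inter>\<M>)"

definition discretely_represented :: "nat set set \<Rightarrow> bool" where
  "discretely_represented I \<longleftrightarrow> (\<exists>k>0. k_maximal k I) \<or> strongly_omega_maximal I"


section \<open>Bounded sequences\<close>

text \<open>As \<open>nat\<close> is discrete, \<open>nat \<Rightarrow>\<^sub>C real\<close> is the Banach space of all bounded real
  sequences with the supremum norm.\<close>

type_synonym linf = "nat \<Rightarrow>\<^sub>C real"

definition chi :: "nat set \<Rightarrow> linf" where
  "chi A = Bcontfun (indicat_real A)"

lemma apply_chi [simp]: "apply_bcontfun (chi A) n = indicat_real A n"
proof -
  have "indicat_real A \<in> bcontfun"
    by (auto simp: bcontfun_def bounded_iff indicator_def intro!: exI[of _ 1])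
  then show ?thesis
    by (simp add: chi_def Bcontfun_inverse)
qed

definition c0_ideal :: "nat set set \<Rightarrow> linf set" where
  "c0_ideal I = {x. \<forall>\<epsilon>>0. {n. \<bar>apply_bcontfun x n\<bar> \<ge> \<epsilon>} \<in> I}"

text \<open>For the dual filter of \<open>L\<close>; the limit exists and is unique when \<open>L\<close> is maximal.\<close>

definition dual_lim :: "nat set set \<Rightarrow> linf \<Rightarrow> real" where
  "dual_lim L x = (THE a. \<forall>\<epsilon>>0. {n. \<bar>apply_bcontfun x n - a\<bar> \<ge> \<epsilon>} \<in> L)"

definition positive_projection :: "(linf \<Rightarrow> linf) \<Rightarrow> bool" where
  "positive_projection Q \<longleftrightarrow>
     bounded_linear Q \<and> Q \<circ> Q = Q \<and>
     (\<forall>x. (\<forall>n. 0 \<le> apply_bcontfun x n) \<longrightarrow> (\<forall>n. 0 \<le> apply_bcontfun (Q x) n))"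

text \<open>Not phrased with \<open>dim\<close>, whose value on infinite-dimensional subspaces is \<open>0\<close>.\<close>

definition infinite_rank :: "(linf \<Rightarrow> linf) \<Rightarrow> bool" where
  "infinite_rank Q \<longleftrightarrow> \<not> (\<exists>B. finite B \<and> range Q = span B)"

end

theory Submission
  imports Defs
begin

text \<open>
  Since \<open>Q\<close> is a linear projection, \<open>T\<close> preserves intersections and \<open>\<nat>\<close> is a fixed set (the empty
  intersection), \<open>T\<close> is an idempotent endomorphism of the Boolean algebra of all subsets of \<open>\<nat>\<close>.
  The kernel of \<open>Q\<close> being \<open>c\<^sub>0\<close> of \<open>I\<close> says that \<open>T\<close>
  annihilates exactly the members of \<open>I\<close>. For each point \<open>n\<close>, evaluation of \<open>T\<close> at \<open>n\<close> is a
  two-valued homomorphism, so the sets \<open>A\<close> with \<open>n \<notin> T A\<close> form a maximal ideal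
  (\<open>prime_point_ideal\<close> and \<open>prime_nat_ideal_imp_maximal\<close>), and \<open>I\<close> is the intersection of these
  point ideals.

  The sets fixed by \<open>T\<close> are its range. By assumption they form a complete field of sets, so \<open>\<nat>\<close>
  is partitioned into atoms, where the atom of \<open>n\<close> is the least fixed set containing \<open>n\<close>. The atom
  decides everything: points in one atom have the same ideal because no set \<open>T A\<close> separates them,
  and the atom of \<open>n\<close> lies in the dual filter of the ideal of \<open>m\<close> only if \<open>m\<close> belongs to it
  (\<open>atom_in_dual_point_ideal_iff\<close>). Hence there is one ideal for each atom, and the atoms are open
  neighbourhoods isolating the dual ultrafilters in \<open>\<beta>\<nat>\<close>. The completeness of the
  field of sets is what makes atoms, and with them discreteness, available.

  The formula for \<open>Q\<close> follows from positivity alone: \<open>x \<mapsto> Q x n\<close> is a positive normalised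
  functional that vanishes on the indicators of the members of the point ideal of \<open>n\<close>, and the only
  such functional is the limit along the dual ultrafilter (\<open>dual_lim_eq_positive_functional\<close>).
  At each coordinate \<open>n\<close> exactly one summand survives, that of the atom of \<open>n\<close>. With finitely many
  atoms the indicators of the atoms span the range of \<open>Q\<close>, so infinite rank forces infinitely many
  atoms.
\<close>

section \<open>Prime ideals, their dual ultrafilters and limits\<close>

text \<open>Point ideals of a Boolean homomorphism are prime by inspection, and primeness is
  the form of maximality that the arguments use.\<close>

definition prime_nat_ideal :: "nat set set \<Rightarrow> bool" where
  "prime_nat_ideal J \<longleftrightarrow> nat_ideal J \<and> (\<forall>A. - A \<in> J \<longleftrightarrow> A \<notin> J)"

lemma prime_nat_ideal_Compl_iff: "prime_nat_ideal J \<Longrightarrow> - A \<in> J \<longleftrightarrow> A \<notin> J"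
  by (simp add: prime_nat_ideal_def)

lemma nat_ideal_Un: "nat_ideal J \<Longrightarrow> A \<in> J \<Longrightarrow> B \<in> J \<Longrightarrow> A \<union> B \<in> J"
  by (simp add: nat_ideal_def)

lemma nat_ideal_subset: "nat_ideal J \<Longrightarrow> A \<in> J \<Longrightarrow> B \<subseteq> A \<Longrightarrow> B \<in> J"
  by (auto simp: nat_ideal_def)

lemma prime_nat_ideal_Un: "prime_nat_ideal J \<Longrightarrow> A \<in> J \<Longrightarrow> B \<in> J \<Longrightarrow> A \<union> B \<in> J"
  by (simp add: prime_nat_ideal_def nat_ideal_Un)

lemma UNIV_notin_prime_nat_ideal:
  assumes "prime_nat_ideal J"
  shows "UNIV \<notin> J"
proof -
  have "{} \<in> J" using assms unfolding prime_nat_ideal_def nat_ideal_def by blast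
  then show ?thesis using prime_nat_ideal_Compl_iff[OF assms, of UNIV] by simp
qed

lemma in_dual_filter_iff: "A \<in> dual_filter J \<longleftrightarrow> - A \<in> J"
  unfolding dual_filter_def by (auto intro: exI[of _ "- A"])

lemma prime_nat_ideal_imp_maximal:
  assumes "prime_nat_ideal J"
  shows "maximal_nat_ideal J"
  unfolding maximal_nat_ideal_def
proof (intro conjI allI impI)
  show "proper_nat_ideal J"
    using assms UNIV_notin_prime_nat_ideal[OF assms]
    unfolding proper_nat_ideal_def prime_nat_ideal_def by blast
next
  fix K assume K: "nat_ideal K \<and> J \<subset> K"
  then obtain A where A: "A \<in> K" "A \<notin> J" by blast
  with K have "- A \<in> K"
    using prime_nat_ideal_Compl_iff[OF assms] by blast
  with A K have "A \<union> - A \<in> K" by (blast intro: nat_ideal_Un)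
  then show "K = UNIV"
    using K by (auto intro: nat_ideal_subset[of K UNIV])
qed

lemma nat_ultrafilter_dual_filter:
  assumes "prime_nat_ideal J"
  shows "nat_ultrafilter (dual_filter J)"
  unfolding nat_ultrafilter_def
proof (intro conjI allI impI)
  have J: "nat_ideal J" using assms by (simp add: prime_nat_ideal_def)
  then show "proper_nat_filter (dual_filter J)"
    using UNIV_notin_prime_nat_ideal[OF assms]
    by (auto simp: proper_nat_filter_def in_dual_filter_iff nat_ideal_def)
  fix V assume V: "proper_nat_filter V \<and> dual_filter J \<subseteq> V"
  show "V = dual_filter J"
  proof (rule ccontr)
    assume "V \<noteq> dual_filter J"
    then obtain A where A: "A \<in> V" "A \<notin> dual_filter J" using V by blast
    then have "- A \<in> dual_filter J"
      using prime_nat_ideal_Compl_iff[OF assms, of A] by (simp add: in_dual_filter_iff)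
    with V A have "A \<inter> - A \<in> V" unfolding proper_nat_filter_def by blast
    with V show False by (simp add: proper_nat_filter_def)
  qed
qed

lemma openin_beta_nat_basic: "openin beta_nat {U. nat_ultrafilter U \<and> A \<in> U}"
  unfolding beta_nat_def by (rule topology_generated_by_Basis) blast

text \<open>A set that belongs to exactly one of the dual ultrafilters cuts out a basic open
  neighbourhood of \<open>\<beta>\<nat>\<close> meeting the collection in that single point.\<close>

lemma discrete_collectionI:
  assumes "countable \<M>"
    and prime: "\<And>L. L \<in> \<M> \<Longrightarrow> prime_nat_ideal L"
    and isolated: "\<And>L. L \<in> \<M> \<Longrightarrow>
      \<exists>A. A \<in> dual_filter L \<and> (\<forall>L'\<in>\<M>. A \<in> dual_filter L' \<longrightarrow> L' = L)"
  shows "discrete_collection \<M>"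
proof -
  let ?D = "dual_filter ` \<M>"
  have "?D \<subseteq> topspace beta_nat"
  proof
    fix U assume "U \<in> ?D"
    then have "nat_ultrafilter U" using prime nat_ultrafilter_dual_filter by blast
    then have "U \<in> {U. nat_ultrafilter U \<and> UNIV \<in> U}"
      by (simp add: nat_ultrafilter_def proper_nat_filter_def)
    then show "U \<in> topspace beta_nat"
      using openin_subset[OF openin_beta_nat_basic[of UNIV]] by blast
  qed
  moreover have "openin (subtopology beta_nat ?D) {U}" if "U \<in> ?D" for U
  proof -
    from that obtain L where L: "L \<in> \<M>" "U = dual_filter L" by blast
    with isolated obtain A where A: "A \<in> dual_filter L"
      "\<forall>L'\<in>\<M>. A \<in> dual_filter L' \<longrightarrow> L' = L" by blast
    then have "{U} = {U. nat_ultrafilter U \<and> A \<in> U} \<inter> ?D"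
      using L prime nat_ultrafilter_dual_filter by blast
    then show ?thesis
      using openin_beta_nat_basic[of A] unfolding openin_subtopology by blast
  qed
  ultimately have "discrete_topology ?D = subtopology beta_nat ?D"
    by (simp add: discrete_topology_unique Int_absorb1)
  then show ?thesis
    using assms(1) prime prime_nat_ideal_imp_maximal by (simp add: discrete_collection_def)
qed

lemma dual_lim_eqI:
  assumes "prime_nat_ideal J"
    and a: "\<And>\<epsilon>. \<epsilon> > 0 \<Longrightarrow> {n. \<bar>apply_bcontfun x n - a\<bar> \<ge> \<epsilon>} \<in> J"
  shows "dual_lim J x = a"
  unfolding dual_lim_def
proof (rule the_equality)
  fix b assume b: "\<forall>\<epsilon>>0. {n. \<bar>apply_bcontfun x n - b\<bar> \<ge> \<epsilon>} \<in> J"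
  show "b = a"
  proof (rule ccontr)
    define e where "e = \<bar>a - b\<bar> / 2"
    assume "b \<noteq> a"
    then have "e > 0" by (simp add: e_def)
    then have "{n. \<bar>apply_bcontfun x n - a\<bar> \<ge> e} \<union> {n. \<bar>apply_bcontfun x n - b\<bar> \<ge> e} \<in> J"
      using a b assms(1) by (simp add: prime_nat_ideal_Un)
    moreover have "{n. \<bar>apply_bcontfun x n - a\<bar> \<ge> e} \<union> {n. \<bar>apply_bcontfun x n - b\<bar> \<ge> e} = UNIV"
      unfolding e_def by (auto simp: abs_if field_simps split: if_splits)
    ultimately show False
      using UNIV_notin_prime_nat_ideal[OF assms(1)] by simp
  qed
qed (use a in blast)

section \<open>Positive functionals that vanish on a prime ideal\<close>

lemma chi_eq_iff [simp]: "chi A = chi B \<longleftrightarrow> A = B"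
proof
  assume "chi A = chi B"
  then have "indicat_real A n = indicat_real B n" for n
    by (metis apply_chi)
  then have "n \<in> A \<longleftrightarrow> n \<in> B" for n
    by (metis indicator_eq_1_iff)
  then show "A = B" by blast
qed simp

lemma chi_empty: "chi {} = 0"
  by (rule bcontfun_eqI) simp

lemma chi_add_Compl: "chi A + chi (- A) = chi UNIV"
  by (rule bcontfun_eqI) (auto simp: indicator_def)

lemma chi_in_c0_ideal_iff:
  assumes "nat_ideal I"
  shows "chi A \<in> c0_ideal I \<longleftrightarrow> A \<in> I"
proof
  assume "chi A \<in> c0_ideal I"
  then have "{n. 1 \<le> \<bar>apply_bcontfun (chi A) n\<bar>} \<in> I"
    unfolding c0_ideal_def by (blast intro: zero_less_one)
  moreover have "{n. 1 \<le> \<bar>apply_bcontfun (chi A) n\<bar>} = A"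
    by (auto simp: indicator_def split: if_splits)
  ultimately show "A \<in> I" by simp
next
  assume "A \<in> I"
  moreover have "{n. e \<le> \<bar>apply_bcontfun (chi A) n\<bar>} \<subseteq> A" if "e > 0" for e :: real
    using that by (auto simp: indicator_def split: if_splits)
  ultimately show "chi A \<in> c0_ideal I"
    using assms nat_ideal_subset unfolding c0_ideal_def by blast
qed

text \<open>If \<open>x\<close> exceeded \<open>\<phi> x\<close> by \<open>\<epsilon>\<close> on a set \<open>S\<close> outside \<open>J\<close>, then \<open>\<phi>\<close> would be blind to the
  complement of \<open>S\<close>, and positivity would give \<open>\<phi> x \<ge> \<phi> x + \<epsilon>\<close>.\<close>

lemma positive_functional_upper_set:
  fixes \<phi> :: "linf \<Rightarrow> real"
  assumes "linear \<phi>"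
    and pos: "\<And>x. (\<And>n. 0 \<le> apply_bcontfun x n) \<Longrightarrow> 0 \<le> \<phi> x"
    and one: "\<phi> (chi UNIV) = 1"
    and J: "prime_nat_ideal J"
    and vanish: "\<And>A. A \<in> J \<Longrightarrow> \<phi> (chi A) = 0"
    and "\<epsilon> > 0"
  shows "{n. apply_bcontfun x n - \<phi> x \<ge> \<epsilon>} \<in> J"
proof (rule ccontr)
  interpret linear \<phi> by fact
  define S where "S = {n. apply_bcontfun x n - \<phi> x \<ge> \<epsilon>}"
  define c where "c = norm x + \<bar>\<phi> x\<bar> + \<epsilon>"
  assume "{n. apply_bcontfun x n - \<phi> x \<ge> \<epsilon>} \<notin> J"
  then have zero: "\<phi> (chi (- S)) = 0"
    using prime_nat_ideal_Compl_iff[OF J] vanish by (simp add: S_def)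
  \<comment> \<open>The constant \<open>c\<close> is so large that on the complement of \<open>S\<close> boundedness of \<open>x\<close> suffices.\<close>
  define y where "y = x - (\<phi> x + \<epsilon>) *\<^sub>R chi UNIV + c *\<^sub>R chi (- S)"
  have "0 \<le> apply_bcontfun y n" for n
  proof -
    have "\<bar>apply_bcontfun x n\<bar> \<le> norm x"
      using norm_bounded[of x n] by simp
    then show ?thesis
      by (cases "n \<in> S") (auto simp: y_def S_def c_def)
  qed
  then have "0 \<le> \<phi> y" by (rule pos)
  also have "\<phi> y = - \<epsilon>"
    by (simp add: y_def add diff scale one zero)
  finally show False using \<open>\<epsilon> > 0\<close> by simp
qed

text \<open>Applying the one-sided estimate to \<open>x\<close> and \<open>- x\<close> identifies \<open>\<phi> x\<close> as the limit. In
  particular the limit exists, without an appeal to compactness.\<close>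

lemma dual_lim_eq_positive_functional:
  fixes \<phi> :: "linf \<Rightarrow> real"
  assumes lin: "linear \<phi>"
    and pos: "\<And>x. (\<And>n. 0 \<le> apply_bcontfun x n) \<Longrightarrow> 0 \<le> \<phi> x"
    and one: "\<phi> (chi UNIV) = 1"
    and J: "prime_nat_ideal J"
    and vanish: "\<And>A. A \<in> J \<Longrightarrow> \<phi> (chi A) = 0"
  shows "dual_lim J x = \<phi> x"
proof (rule dual_lim_eqI[OF J])
  fix \<epsilon> :: real assume "\<epsilon> > 0"
  note upper = positive_functional_upper_set[OF lin pos one J vanish \<open>\<epsilon> > 0\<close>]
  have "{n. \<bar>apply_bcontfun x n - \<phi> x\<bar> \<ge> \<epsilon>} =
      {n. apply_bcontfun x n - \<phi> x \<ge> \<epsilon>} \<union> {n. apply_bcontfun (- x) n - \<phi> (- x) \<ge> \<epsilon>}"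
    by (auto simp: linear_neg[OF lin])
  also have "\<dots> \<in> J"
    using upper[of x] upper[of "- x"] J by (simp add: prime_nat_ideal_Un)
  finally show "{n. \<bar>apply_bcontfun x n - \<phi> x\<bar> \<ge> \<epsilon>} \<in> J" .
qed

section \<open>Idempotent Boolean endomorphisms with a complete field of fixed sets\<close>

locale complete_set_projection =
  fixes T :: "nat set \<Rightarrow> nat set"
  assumes T_Int: "T (A \<inter> B) = T A \<inter> T B"
    and T_Compl: "T (- A) = - T A"
    and T_idem: "T (T A) = T A"
    and T_finite: "finite A \<Longrightarrow> T A = {}"
    and T_Inter_fixed: "(\<And>B. B \<in> \<S> \<Longrightarrow> T B = B) \<Longrightarrow> T (\<Inter>\<S>) = \<Inter>\<S>"
begin

lemma T_Un: "T (A \<union> B) = T A \<union> T B"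
proof -
  have "T (A \<union> B) = T (- (- A \<inter> - B))" by simp
  also have "\<dots> = - (- T A \<inter> - T B)" by (simp only: T_Compl T_Int)
  finally show ?thesis by simp
qed

lemma T_mono: "A \<subseteq> B \<Longrightarrow> T A \<subseteq> T B"
  using T_Int[of A B] by (simp add: inf_absorb1 inf.absorb_iff1)

definition point_ideal :: "nat \<Rightarrow> nat set set" where
  "point_ideal n = {A. n \<notin> T A}"

definition atom :: "nat \<Rightarrow> nat set" where
  "atom n = \<Inter>{B. T B = B \<and> n \<in> B}"

definition representatives :: "nat set" where
  "representatives = (\<lambda>n. LEAST m. m \<in> atom n) ` UNIV"

lemma prime_point_ideal: "prime_nat_ideal (point_ideal n)"
  unfolding prime_nat_ideal_def nat_ideal_def point_ideal_def
  using T_mono by (auto simp: T_Un T_Compl T_finite)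

lemma Inter_point_ideal: "(\<Inter>n. point_ideal n) = {A. T A = {}}"
  by (auto simp: point_ideal_def)

lemma mem_atom: "n \<in> atom n"
  by (simp add: atom_def)

lemma T_atom: "T (atom n) = atom n"
  unfolding atom_def by (rule T_Inter_fixed) simp

lemma atom_subset: "T B = B \<Longrightarrow> n \<in> B \<Longrightarrow> atom n \<subseteq> B"
  unfolding atom_def by blast

text \<open>Minimality alone gives one inclusion; if \<open>n\<close> were outside the atom of \<open>m\<close>, then the atom of
  \<open>n\<close> minus the atom of \<open>m\<close> would be a smaller fixed set around \<open>n\<close>.\<close>

lemma atom_eq:
  assumes "m \<in> atom n"
  shows "atom m = atom n"
proof
  show "atom m \<subseteq> atom n"
    using assms by (intro atom_subset T_atom)
  have "n \<in> atom m"
  proof (rule ccontr)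
    assume "n \<notin> atom m"
    then have "atom n \<subseteq> - atom m"
      by (intro atom_subset) (simp_all add: T_Compl T_atom)
    with assms mem_atom[of m] show False by blast
  qed
  then show "atom n \<subseteq> atom m"
    by (intro atom_subset T_atom)
qed

text \<open>Every \<open>T A\<close> is fixed, hence a union of atoms.\<close>

lemma point_ideal_eq:
  assumes "m \<in> atom n"
  shows "point_ideal m = point_ideal n"
proof -
  have "m \<in> T A \<longleftrightarrow> n \<in> T A" for A
    using atom_subset[OF T_idem, of _ A] atom_eq[OF assms] mem_atom by blast
  then show ?thesis by (simp add: point_ideal_def)
qed

lemma atom_in_dual_point_ideal_iff: "atom n \<in> dual_filter (point_ideal m) \<longleftrightarrow> m \<in> atom n"
  by (simp add: in_dual_filter_iff point_ideal_def T_Compl T_atom)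

text \<open>Choosing least elements makes the representative of a point of \<open>atom n\<close> unique.\<close>

lemma representative_exists:
  obtains m where "m \<in> representatives" "m \<in> atom n"
  using LeastI[of "\<lambda>m. m \<in> atom n", OF mem_atom] unfolding representatives_def by blast

lemma representative_unique:
  assumes "m \<in> representatives" "k \<in> representatives" "m \<in> atom k"
  shows "m = k"
proof -
  have least: "r = (LEAST j. j \<in> atom r)" if r: "r \<in> representatives" for r
  proof -
    from r obtain n where n: "r = (LEAST j. j \<in> atom n)" by (auto simp: representatives_def)
    then have "r \<in> atom n" using LeastI[of "\<lambda>m. m \<in> atom n", OF mem_atom] by simp
    then show ?thesis using n atom_eq by simp
  qed
  have "m = (LEAST j. j \<in> atom m)" by (rule least[OF assms(1)])
  also have "\<dots> = (LEAST j. j \<in> atom k)" by (simp only: atom_eq[OF assms(3)])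
  also have "\<dots> = k" by (rule least[OF assms(2), symmetric])
  finally show ?thesis .
qed

lemma inj_on_point_ideal: "inj_on point_ideal representatives"
proof (rule inj_onI)
  fix m k assume mk: "m \<in> representatives" "k \<in> representatives" "point_ideal m = point_ideal k"
  then have "m \<in> atom k"
    using atom_in_dual_point_ideal_iff[of k m] atom_in_dual_point_ideal_iff[of k k] mem_atom by simp
  then show "m = k" using mk representative_unique by blast
qed

lemma discrete_point_ideals: "discrete_collection (point_ideal ` representatives)"
proof (rule discrete_collectionI)
  fix L assume "L \<in> point_ideal ` representatives"
  then obtain n where n: "L = point_ideal n" by blast
  show "\<exists>A. A \<in> dual_filter L \<and>
      (\<forall>L'\<in>point_ideal ` representatives. A \<in> dual_filter L' \<longrightarrow> L' = L)"
    using n mem_atom point_ideal_eq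
    by (intro exI[of _ "atom n"]) (auto simp: atom_in_dual_point_ideal_iff)
next
  show "prime_nat_ideal L" if "L \<in> point_ideal ` representatives" for L
    using that prime_point_ideal by blast
qed (rule countable_image[OF countableI_type])

lemma Inter_representative_ideals:
  "(\<Inter>m\<in>representatives. point_ideal m) = {A. T A = {}}"
proof -
  have "point_ideal n \<in> point_ideal ` representatives" for n
  proof -
    obtain m where "m \<in> representatives" "m \<in> atom n" by (rule representative_exists)
    then show ?thesis using point_ideal_eq[of m n] by (simp add: rev_image_eqI)
  qed
  then have "point_ideal ` representatives = range point_ideal" by blast
  then show ?thesis using Inter_point_ideal by simp
qed

lemma disjoint_atoms: "disjoint_family_on atom representatives"
  unfolding disjoint_family_on_def
proof (intro ballI impI)
  fix m k assume mk: "m \<in> representatives" "k \<in> representatives" "m \<noteq> k"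
  show "atom m \<inter> atom k = {}"
  proof (rule ccontr)
    assume "atom m \<inter> atom k \<noteq> {}"
    then have "atom m = atom k" using atom_eq by blast
    then show False using mk representative_unique mem_atom by blast
  qed
qed

lemma UN_atoms: "(\<Union>m\<in>representatives. atom m) = UNIV"
proof -
  have "n \<in> (\<Union>m\<in>representatives. atom m)" for n
  proof -
    obtain m where m: "m \<in> representatives" "m \<in> atom n" by (rule representative_exists)
    then have "n \<in> atom m" using atom_eq[OF m(2)] mem_atom by simp
    then show ?thesis using m(1) by blast
  qed
  then show ?thesis by blast
qed

end

section \<open>The representation theorem\<close>

theorem theorem6p7:
  fixes I :: "nat set set"
    and Q :: "linf \<Rightarrow> linf"
    and T :: "nat set \<Rightarrow> nat set"
  assumes "proper_nat_ideal I"
    and A: "positive_projection Q" "{x. Q x = 0} = c0_ideal I"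
    and B: "\<And>A. Q (chi A) = chi (T A)"
    and C: "\<And>A B. T (A \<inter> B) = T A \<inter> T B"
    and D: "\<And>\<S>. \<S> \<subseteq> {B. T B = B} \<Longrightarrow> \<Inter>\<S> \<in> {B. T B = B}"
  shows "discretely_represented I \<and>
    (\<exists>(F :: nat set) (J :: nat \<Rightarrow> nat set set) (A :: nat \<Rightarrow> nat set).
       inj_on J F \<and> discrete_collection (J ` F) \<and> I = (\<Inter>m\<in>F. J m) \<and>
       disjoint_family_on A F \<and> (\<Union>m\<in>F. A m) = UNIV \<and>
       (\<forall>m\<in>F. A m \<in> dual_filter (J m)) \<and>
       (\<forall>x n. ((\<lambda>m. dual_lim (J m) x * apply_bcontfun (chi (A m)) n)
                 has_sum apply_bcontfun (Q x) n) F)) \<and>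
    (infinite_rank Q \<longrightarrow> strongly_omega_maximal I)"
proof -
  have I: "nat_ideal I" using assms(1) by (simp add: proper_nat_ideal_def)
  have lin: "linear Q" and QQ: "Q (Q x) = Q x"
    and Qpos: "(\<And>n. 0 \<le> apply_bcontfun x n) \<Longrightarrow> 0 \<le> apply_bcontfun (Q x) n" for x n
    using A(1) by (auto simp: positive_projection_def bounded_linear.linear fun_eq_iff)
  interpret Q: linear Q by fact
  have T_empty_iff: "T A = {} \<longleftrightarrow> A \<in> I" for A
  proof -
    have "T A = {} \<longleftrightarrow> Q (chi A) = 0"
      by (metis B chi_empty chi_eq_iff)
    also have "\<dots> \<longleftrightarrow> chi A \<in> c0_ideal I" using A(2) by blast
    finally show ?thesis using chi_in_c0_ideal_iff[OF I] by simp
  qed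
  have T_UNIV: "T UNIV = UNIV" using D[of "{}"] by simp
  have T_Compl: "T (- A) = - T A" for A
  proof -
    \<comment> \<open>Additivity of \<open>Q\<close> makes the images of \<open>A\<close> and its complement partition \<open>T UNIV\<close>.\<close>
    have "chi (T A) + chi (T (- A)) = chi UNIV"
      using Q.add[of "chi A" "chi (- A)"] by (simp add: B chi_add_Compl T_UNIV)
    also have "\<dots> = chi (T A) + chi (- T A)"
      by (simp add: chi_add_Compl)
    finally show ?thesis by simp
  qed
  interpret complete_set_projection T
  proof
    show "T (T A) = T A" for A using QQ[of "chi A"] by (simp add: B)
    show "T A = {}" if "finite A" for A
      using that I by (simp add: T_empty_iff nat_ideal_def)
    show "T (\<Inter>\<S>) = \<Inter>\<S>" if "\<And>B. B \<in> \<S> \<Longrightarrow> T B = B" for \<S>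
      using D[of \<S>] that by blast
  qed (fact C T_Compl)+
  let ?F = representatives
  have I_eq: "I = (\<Inter>m\<in>?F. point_ideal m)"
    by (simp add: Inter_representative_ideals T_empty_iff)
  have Q_lim: "dual_lim (point_ideal n) x = apply_bcontfun (Q x) n" for x n
  proof (rule dual_lim_eq_positive_functional[OF _ _ _ prime_point_ideal])
    show "linear (\<lambda>x. apply_bcontfun (Q x) n)"
      by (rule linearI) (simp_all add: Q.add Q.scale)
  qed (auto simp: Qpos B T_UNIV point_ideal_def)
  have Q_eq_on_atom: "apply_bcontfun (Q x) m = apply_bcontfun (Q x) n" if "m \<in> atom n" for x m n
    using Q_lim[of m x] Q_lim[of n x] point_ideal_eq[OF that] by simp
  have has_sum: "((\<lambda>m. dual_lim (point_ideal m) x * apply_bcontfun (chi (atom m)) n)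
      has_sum apply_bcontfun (Q x) n) ?F" for x n
  proof -
    obtain k where k: "k \<in> ?F" "k \<in> atom n" by (rule representative_exists)
    have nk: "n \<in> atom k" using atom_eq[OF k(2)] mem_atom by simp
    have other: "apply_bcontfun (chi (atom m)) n = 0" if "m \<in> ?F - {k}" for m
    proof -
      have "n \<notin> atom m"
        using that k nk disjoint_atoms unfolding disjoint_family_on_def by blast
      then show ?thesis by simp
    qed
    have "dual_lim (point_ideal k) x * apply_bcontfun (chi (atom k)) n = apply_bcontfun (Q x) n"
      using nk Q_eq_on_atom[OF k(2)] by (simp add: Q_lim)
    then have "((\<lambda>m. dual_lim (point_ideal m) x * apply_bcontfun (chi (atom m)) n) has_sum
        apply_bcontfun (Q x) n) {k}"
      by (simp add: has_sum_finite_iff)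
    also have "?this \<longleftrightarrow> ?thesis"
      using k other by (intro has_sum_cong_neutral) auto
    finally show ?thesis .
  qed
  have omega: "strongly_omega_maximal I" if "infinite ?F"
    unfolding strongly_omega_maximal_def
    using that discrete_point_ideals I_eq inj_on_point_ideal finite_imageD by blast
  have k_max: "\<exists>k>0. k_maximal k I" if "finite ?F"
  proof -
    have "?F \<noteq> {}" using representative_exists by blast
    with that have "card (point_ideal ` ?F) > 0" by (simp add: card_gt_0_iff)
    then show ?thesis
      unfolding k_maximal_def
      using that I_eq prime_nat_ideal_imp_maximal[OF prime_point_ideal] by blast
  qed
  have finite_rank: "\<not> infinite_rank Q" if "finite ?F"
  proof -
    have "Q x = (\<Sum>m\<in>?F. dual_lim (point_ideal m) x *\<^sub>R chi (atom m))" for x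
    proof (rule bcontfun_eqI)
      have sum_apply: "apply_bcontfun (\<Sum>m\<in>G. f m) n = (\<Sum>m\<in>G. apply_bcontfun (f m) n)"
        for G :: "nat set" and f :: "nat \<Rightarrow> linf" and n
        by (induction G rule: infinite_finite_induct) simp_all
      fix n show "apply_bcontfun (Q x) n =
          apply_bcontfun (\<Sum>m\<in>?F. dual_lim (point_ideal m) x *\<^sub>R chi (atom m)) n"
        using has_sum[of x n] that
        by (simp add: has_sum_finite_iff sum_apply)
    qed
    moreover have "(\<Sum>m\<in>?F. dual_lim (point_ideal m) x *\<^sub>R chi (atom m))
        \<in> span ((\<lambda>m. chi (atom m)) ` ?F)" for x
      by (intro span_sum span_scale span_base imageI)
    ultimately have "range Q \<subseteq> span ((\<lambda>m. chi (atom m)) ` ?F)" by auto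
    moreover have "span ((\<lambda>m. chi (atom m)) ` ?F) \<subseteq> range Q"
    proof (rule span_minimal)
      have "chi (atom m) = Q (chi (atom m))" for m by (simp add: B T_atom)
      then show "(\<lambda>m. chi (atom m)) ` ?F \<subseteq> range Q" by blast
      show "subspace (range Q)" by (rule linear_subspace_image[OF lin subspace_UNIV])
    qed
    ultimately show ?thesis
      using that unfolding infinite_rank_def by blast
  qed
  have "discretely_represented I"
    using omega k_max unfolding discretely_represented_def by blast
  moreover have "infinite_rank Q \<longrightarrow> strongly_omega_maximal I"
    using omega finite_rank by blast
  moreover have "\<forall>m\<in>?F. atom m \<in> dual_filter (point_ideal m)"
    by (simp add: atom_in_dual_point_ideal_iff mem_atom)
  ultimately show ?thesis
    using inj_on_point_ideal discrete_point_ideals I_eq disjoint_atoms UN_atoms has_sum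
    by (intro conjI exI[of _ ?F] exI[of _ point_ideal] exI[of _ atom]) simp_all
qed

end
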